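(* Let $p$ be a prime. For all $n\ge0$, $\tfrac{1}{n!}\nabla^nq = \mathscr{S}^{-n}(q)$. Therefore, $\operatorname{Im}(\mathscr{I})$ consists of the functions $$\Psi = \sum_{n=0}^\infty a_n(-1)^n\mathscr{S}^{-n}(q)$$ where $(a_n)_{n\ge0}$ is a sequence in $\mathbb{C}_p$ converging to zero. The $a_n$ are determined uniquely by $\Psi$.
   Context: $C(\mathbb{Z}_p,\mathbb{C}_p)$ is the $\mathbb{C}_p$-vector space of continuous functions $\mathbb{Z}_p \to \mathbb{C}_p$, and $\mathscr{S}$ is the $\mathbb{C}_p$-linear automorphism of it given by $\mathscr{S}(\phi)(x) = \phi(x) - x\phi(x-1)$; $\mathscr{S}^{-n}$ is the $n$th iterate of $\mathscr{S}^{-1}$. The function $q = \mathscr{S}^{-1}(\mathbf{1})$, with $\mathbf{1}$ the constant function $1$; explicitly $q(x) = \sum_{n=0}^\infty n!\binom{x}{n}$. The operator $\nabla$ is the forward difference, $(\nabla\phi)(x) = \phi(x+1)-\phi(x)$. The map $\mathscr{I}$ on $C(\mathbb{Z}_p,\mathbb{C}_p)$ is $\mathscr{I}(\psi)(s) = \sum_{n=0}^\infty n!\,\psi(-1-n)\binom{s}{n}$ for $s\in\mathbb{Z}_p$, and $\operatorname{Im}(\mathscr{I})$ is its image (a set of continuous functions $\mathbb{Z}_p\to\mathbb{C}_p$). *)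

theory Defs
  imports "HOL-Analysis.Analysis" "HOL-Computational_Algebra.Computational_Algebra"
begin

text \<open>
  Fields with a multiplicative non-archimedean absolute value, carrying the topology it induces.
  (The library's \<open>norm\<close> is constrained to real normed vector spaces, which excludes the p-adic
  case.)
\<close>

class nonarchimedean_field = field_char_0 + metric_space +
  fixes vabs :: "'a \<Rightarrow> real"
  assumes dist_vabs: "dist x y = vabs (x - y)"
    and vabs_mult: "vabs (x * y) = vabs x * vabs y"
    and vabs_add_le_max: "vabs (x + y) \<le> max (vabs x) (vabs y)"

definition padic_abs :: "nat \<Rightarrow> rat \<Rightarrow> real" where
  "padic_abs p r = (if r = 0 then 0 else
     (case quotient_of r of (a, b) \<Rightarrow>
        real p powi (int (multiplicity (int p) b) - int (multiplicity (int p) a))))"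

text \<open>
  The following sets live inside an ambient field, which is going to be \<open>\<complex>\<^sub>p\<close>. There the closure
  of the rationals is complete, hence it is the completion \<open>\<rat>\<^sub>p\<close> of the rationals. The prime
  enters only through the absolute value of the ambient field.
\<close>

definition padic_numbers :: "'a::nonarchimedean_field set" where
  "padic_numbers = closure \<rat>"

definition padic_integers :: "'a::nonarchimedean_field set" where
  "padic_integers = {x \<in> padic_numbers. vabs x \<le> 1}"

definition padic_algebraic :: "'a::nonarchimedean_field set" where
  "padic_algebraic =
     {x. \<exists>f :: 'a poly. f \<noteq> 0 \<and> (\<forall>i. coeff f i \<in> padic_numbers) \<and> poly f x = 0}"

text \<open>
  \<open>is_complex_padic_field TYPE('a) p\<close> says that \<open>'a\<close> is \<open>\<complex>\<^sub>p\<close>, the completion of an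
  algebraic closure of \<open>\<rat>\<^sub>p\<close>: its absolute value extends the p-adic one on the rationals,
  the elements algebraic over \<open>\<rat>\<^sub>p\<close> form an algebraically closed field, they are dense,
  and the whole field is complete. This determines \<open>'a\<close> up to isometric isomorphism.
\<close>

definition is_complex_padic_field :: "'a::nonarchimedean_field itself \<Rightarrow> nat \<Rightarrow> bool" where
  "is_complex_padic_field _ p \<longleftrightarrow>
     (\<forall>r. vabs (of_rat r :: 'a) = padic_abs p r) \<and>
     (\<forall>f :: 'a poly. (\<forall>i. coeff f i \<in> padic_algebraic) \<and> degree f > 0 \<longrightarrow>
        (\<exists>x \<in> padic_algebraic. poly f x = 0)) \<and>
     closure (padic_algebraic :: 'a set) = UNIV \<and>
     complete (UNIV :: 'a set)"

text \<open>
  Functions on \<open>\<int>\<^sub>p\<close> are represented by functions on the ambient field that are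
  \<open>undefined\<close> outside \<open>\<int>\<^sub>p\<close>, so that equality is equality on \<open>\<int>\<^sub>p\<close>.
\<close>

definition padic_cont :: "('a::nonarchimedean_field \<Rightarrow> 'a) set" where
  "padic_cont = {\<phi> \<in> extensional padic_integers. continuous_on padic_integers \<phi>}"

definition S_op :: "('a::nonarchimedean_field \<Rightarrow> 'a) \<Rightarrow> ('a \<Rightarrow> 'a)" where
  "S_op \<phi> = (\<lambda>x\<in>padic_integers. \<phi> x - x * \<phi> (x - 1))"

definition S_inv :: "('a::nonarchimedean_field \<Rightarrow> 'a) \<Rightarrow> ('a \<Rightarrow> 'a)" where
  "S_inv = inv_into padic_cont S_op"

definition q_fun :: "'a::nonarchimedean_field \<Rightarrow> 'a" where
  "q_fun = S_inv (\<lambda>x\<in>padic_integers. 1)"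

definition nabla :: "('a::nonarchimedean_field \<Rightarrow> 'a) \<Rightarrow> ('a \<Rightarrow> 'a)" where
  "nabla \<phi> = (\<lambda>x\<in>padic_integers. \<phi> (x + 1) - \<phi> x)"

definition I_op :: "('a::nonarchimedean_field \<Rightarrow> 'a) \<Rightarrow> ('a \<Rightarrow> 'a)" where
  "I_op \<psi> = (\<lambda>s\<in>padic_integers. \<Sum>n. fact n * \<psi> (- 1 - of_nat n) * (s gchoose n))"

text \<open>Convergence of a series in the Banach space of continuous functions (sup norm).\<close>

definition padic_cont_sums ::
    "(nat \<Rightarrow> 'a::nonarchimedean_field \<Rightarrow> 'a) \<Rightarrow> ('a \<Rightarrow> 'a) \<Rightarrow> bool" where
  "padic_cont_sums F \<Psi> \<longleftrightarrow> \<Psi> \<in> padic_cont \<and>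
     uniform_limit padic_integers (\<lambda>N x. \<Sum>n<N. F n x) \<Psi> sequentially"

end

theory Submission imports Defs
begin

text \<open>
  The idea is to compute with Mahler coefficients. If \<open>c\<close> tends to zero, then
  \<open>\<Sum>c\<^sub>n (x choose n)\<close> converges uniformly on the p-adic integers, because binomials have absolute
  value at most 1 there; call the sum \<open>mahler_series c\<close>. The coefficients can be read off as the
  iterated differences at 0, and by Mahler's theorem (\<open>Mahler\<close>) every continuous function is such
  a series. The operators of the theorem act on the coefficients in a simple way:

  \<^item> \<open>nabla\<close> maps \<open>c\<^sub>n\<close> to \<open>c\<^sub>n\<^sub>+\<^sub>1\<close>, by Pascal's rule;
  \<^item> \<open>S_op\<close> maps \<open>c\<^sub>n\<close> to \<open>c\<^sub>n - n c\<^sub>n\<^sub>-\<^sub>1\<close>, by the absorption identity;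
  \<^item> \<open>I_op \<psi>\<close> has the coefficients \<open>n! \<psi>(-1 - n)\<close>, by definition.

  The second point shows that \<open>S_op\<close> is injective, that \<open>q\<close> has the coefficients \<open>n!\<close>, and that
  \<open>S\<^sup>-\<^sup>m q\<close> has the coefficients \<open>(n + m)! / m!\<close>. The first point gives the same coefficients for
  \<open>\<nabla>\<^sup>m q / m!\<close>.

  By upper negation, \<open>(-1)\<^sup>m (n + m)! / m! = n! (-1 - n choose m)\<close>. So \<open>(-1)\<^sup>m S\<^sup>-\<^sup>m q\<close> is the image
  under \<open>I_op\<close> of the binomial function of degree \<open>m\<close>. Since \<open>I_op\<close> is linear and does not increase
  the sup norm, it maps \<open>mahler_series a\<close> to \<open>\<Sum>a\<^sub>m (-1)\<^sup>m S\<^sup>-\<^sup>m q\<close>; this is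
  \<open>I_op_mahler_series_sums\<close>. As every continuous function is a Mahler series, these sums form the
  image of \<open>I_op\<close>. The \<open>a\<^sub>m\<close> are unique because \<open>I_op\<close> is injective, its coefficients giving the
  values of \<open>\<psi>\<close> on the dense set of negative integers, and because Mahler coefficients are unique.
\<close>

section \<open>Non-archimedean fields\<close>

lemma dist_0_vabs: "dist x 0 = vabs x" for x :: "'a::nonarchimedean_field"
  by (simp add: dist_vabs)

lemma vabs_zero [simp]: "vabs (0::'a::nonarchimedean_field) = 0"
  by (metis dist_0_vabs dist_self)

lemma vabs_nonneg [simp]: "0 \<le> vabs (x::'a::nonarchimedean_field)"
  by (metis dist_0_vabs zero_le_dist)

lemma vabs_eq_0_iff [simp]: "vabs (x::'a::nonarchimedean_field) = 0 \<longleftrightarrow> x = 0"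
  by (metis dist_0_vabs dist_eq_0_iff)

lemma vabs_one [simp]: "vabs (1::'a::nonarchimedean_field) = 1"
  using vabs_mult[of 1 "1::'a"] by auto

lemma vabs_minus_commute: "vabs (x - y) = vabs (y - x)" for x y :: "'a::nonarchimedean_field"
  by (metis dist_commute dist_vabs)

lemma vabs_minus [simp]: "vabs (- x) = vabs (x::'a::nonarchimedean_field)"
  using vabs_minus_commute[of 0 x] by simp

lemma vabs_diff_le_max: "vabs (x - y) \<le> max (vabs x) (vabs y)" for x y :: "'a::nonarchimedean_field"
  using vabs_add_le_max[of x "- y"] by simp

lemma vabs_power: "vabs (x ^ n) = vabs x ^ n" for x :: "'a::nonarchimedean_field"
  by (induction n) (auto simp: vabs_mult)

lemma vabs_divide: "vabs (x / y) = vabs x / vabs y" for x y :: "'a::nonarchimedean_field"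
proof (cases "y = 0")
  case False
  then show ?thesis using vabs_mult[of "x / y" y] by (simp add: field_simps)
qed simp

lemma vabs_sum_le:
  fixes f :: "'b \<Rightarrow> 'a::nonarchimedean_field"
  assumes "\<And>i. i \<in> A \<Longrightarrow> vabs (f i) \<le> B" "0 \<le> B"
  shows "vabs (\<Sum>i\<in>A. f i) \<le> B"
  using assms
proof (induction A rule: infinite_finite_induct)
  case (insert a A)
  then show ?case using vabs_add_le_max[of "f a" "\<Sum>i\<in>A. f i"] by force
qed auto

lemma vabs_of_nat_le_1: "vabs (of_nat n :: 'a::nonarchimedean_field) \<le> 1"
  using vabs_sum_le[of "{..<n}" "\<lambda>_. 1::'a" 1] by simp

lemma vabs_of_int_le_1: "vabs (of_int n :: 'a::nonarchimedean_field) \<le> 1"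
  by (cases n) (auto simp del: of_nat_Suc simp: vabs_of_nat_le_1)

lemma tendsto_iff_vabs:
  "(f \<longlongrightarrow> l) F \<longleftrightarrow> ((\<lambda>x. vabs (f x - l)) \<longlongrightarrow> 0) F"
  for l :: "'a::nonarchimedean_field"
  by (subst tendsto_dist_iff) (simp add: dist_vabs)

lemma tendsto_0_iff_vabs: "(f \<longlongrightarrow> 0) F \<longleftrightarrow> ((\<lambda>x. vabs (f x)) \<longlongrightarrow> 0) F"
  for f :: "'b \<Rightarrow> 'a::nonarchimedean_field"
  by (subst tendsto_iff_vabs) simp

text \<open>
  Addition and multiplication are continuous: the increment of a sum or a product is bounded by the
  increments of the two arguments.
\<close>

instance nonarchimedean_field \<subseteq> topological_ab_group_add
proof
  fix a b :: 'a
  let ?F = "nhds a \<times>\<^sub>F nhds b"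
  have fst: "((\<lambda>x. vabs (fst x - a)) \<longlongrightarrow> 0) ?F"
    by (subst tendsto_iff_vabs[symmetric]) (rule filterlim_fst)
  have snd: "((\<lambda>x. vabs (snd x - b)) \<longlongrightarrow> 0) ?F"
    by (subst tendsto_iff_vabs[symmetric]) (rule filterlim_snd)
  have "((\<lambda>x. max (vabs (fst x - a)) (vabs (snd x - b))) \<longlongrightarrow> 0) ?F"
    using tendsto_max[OF fst snd] by simp
  then have "((\<lambda>x. vabs (fst x + snd x - (a + b))) \<longlongrightarrow> 0) ?F"
    by (rule Lim_null_comparison[rotated])
       (use vabs_add_le_max[of "fst x - a" "snd x - b" for x] in
         \<open>auto intro!: always_eventually simp: algebra_simps\<close>)
  then show "((\<lambda>x. fst x + snd x) \<longlongrightarrow> a + b) ?F"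
    by (subst tendsto_iff_vabs)
  show "(uminus \<longlongrightarrow> - a) (nhds a)"
  proof (subst tendsto_iff_vabs)
    have "((\<lambda>x. vabs (x - a)) \<longlongrightarrow> 0) (nhds a)"
      by (subst tendsto_iff_vabs[symmetric]) (rule filterlim_ident)
    then show "((\<lambda>x. vabs (- x - - a)) \<longlongrightarrow> 0) (nhds a)"
      by (simp add: vabs_minus_commute)
  qed
qed

instance nonarchimedean_field \<subseteq> topological_semigroup_mult
proof
  fix a b :: 'a
  let ?F = "nhds a \<times>\<^sub>F nhds b"
  have fst: "((\<lambda>x. vabs (fst x - a)) \<longlongrightarrow> 0) ?F"
    by (subst tendsto_iff_vabs[symmetric]) (rule filterlim_fst)
  have snd: "((\<lambda>x. vabs (snd x - b)) \<longlongrightarrow> 0) ?F"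
    by (subst tendsto_iff_vabs[symmetric]) (rule filterlim_snd)
  have lim: "((\<lambda>x. max (vabs (fst x - a) * vabs (snd x - b))
               (max (vabs a * vabs (snd x - b)) (vabs (fst x - a) * vabs b))) \<longlongrightarrow> 0) ?F"
    by (rule tendsto_eq_intros fst snd refl | simp)+
  have "vabs (fst x * snd x - a * b) \<le> max (vabs (fst x - a) * vabs (snd x - b))
          (max (vabs a * vabs (snd x - b)) (vabs (fst x - a) * vabs b))" for x
  proof -
    have "fst x * snd x - a * b =
        (fst x - a) * (snd x - b) + (a * (snd x - b) + (fst x - a) * b)"
      by (simp add: algebra_simps)
    then show ?thesis
      using vabs_add_le_max[of "(fst x - a) * (snd x - b)" "a * (snd x - b) + (fst x - a) * b"]
        vabs_add_le_max[of "a * (snd x - b)" "(fst x - a) * b"]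
      by (simp only: vabs_mult)
  qed
  then have "((\<lambda>x. vabs (fst x * snd x - a * b)) \<longlongrightarrow> 0) ?F"
    by (intro Lim_null_comparison[OF _ lim]) (auto intro!: always_eventually)
  then show "((\<lambda>x. fst x * snd x) \<longlongrightarrow> a * b) ?F"
    by (subst tendsto_iff_vabs)
qed

lemma continuous_on_vabs [continuous_intros]:
  "continuous_on A f \<Longrightarrow> continuous_on A (\<lambda>x. vabs (f x :: 'a::nonarchimedean_field))"
  unfolding dist_0_vabs[symmetric] by (intro continuous_intros)

lemma tendsto_vabs: "(f \<longlongrightarrow> l) F \<Longrightarrow> ((\<lambda>x. vabs (f x)) \<longlongrightarrow> vabs l) F"
  for l :: "'a::nonarchimedean_field"
  unfolding dist_0_vabs[symmetric] by (intro tendsto_intros)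

lemma tendsto_0_mult_bounded:
  fixes f g :: "nat \<Rightarrow> 'a::nonarchimedean_field"
  assumes "f \<longlonglongrightarrow> 0" "\<And>n. vabs (g n) \<le> B"
  shows "(\<lambda>n. f n * g n) \<longlonglongrightarrow> 0"
proof -
  have "(\<lambda>n. vabs (f n) * B) \<longlonglongrightarrow> 0"
    using tendsto_mult_right[of "\<lambda>n. vabs (f n)" 0 sequentially B] assms(1)
    by (simp add: tendsto_0_iff_vabs)
  then show ?thesis
    unfolding tendsto_0_iff_vabs[of "\<lambda>n. f n * g n"]
    by (rule Lim_null_comparison[rotated])
       (use assms(2) in \<open>auto intro!: always_eventually mult_left_mono simp: vabs_mult\<close>)
qed

lemma sums_mult_const:
  fixes c :: "'a::nonarchimedean_field"
  assumes "f sums s"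
  shows "(\<lambda>n. c * f n) sums (c * s)"
  using assms unfolding sums_def sum_distrib_left[symmetric] by (rule tendsto_mult_left)

lemma sums_diff_nonarch:
  fixes f g :: "nat \<Rightarrow> 'a::nonarchimedean_field"
  assumes "f sums s" "g sums t"
  shows "(\<lambda>n. f n - g n) sums (s - t)"
  using assms unfolding sums_def sum_subtractf by (rule tendsto_diff)

lemma vabs_sums_le:
  fixes f :: "nat \<Rightarrow> 'a::nonarchimedean_field"
  assumes "f sums s" "\<And>n. vabs (f n) \<le> B"
  shows "vabs s \<le> B"
proof -
  have "0 \<le> B" using assms(2)[of 0] vabs_nonneg order_trans by blast
  then have "vabs (\<Sum>i<n. f i) \<le> B" for n by (intro vabs_sum_le assms)
  moreover have "(\<lambda>n. vabs (\<Sum>i<n. f i)) \<longlonglongrightarrow> vabs s"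
    using assms(1) unfolding sums_def by (rule tendsto_vabs)
  ultimately show ?thesis by (intro LIMSEQ_le_const2) auto
qed

text \<open>
  The ultrametric inequality turns the Cauchy criterion into a condition on single terms.
\<close>

lemma summable_nonarch:
  fixes f :: "nat \<Rightarrow> 'a::nonarchimedean_field"
  assumes compl: "complete (UNIV :: 'a set)" and lim: "f \<longlonglongrightarrow> 0"
  shows "summable f"
proof -
  have "Cauchy (\<lambda>n. \<Sum>i<n. f i)"
  proof (rule metric_CauchyI)
    fix e :: real assume "e > 0"
    then obtain N where N: "\<And>n. n \<ge> N \<Longrightarrow> vabs (f n) < e / 2"
      using lim unfolding LIMSEQ_def by (metis dist_0_vabs half_gt_zero)
    have half: "dist (\<Sum>i<m. f i) (\<Sum>i<n. f i) < e" if "N \<le> m" "m \<le> n" for m n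
    proof -
      have "(\<Sum>i<n. f i) - (\<Sum>i<m. f i) = (\<Sum>i=m..<n. f i)"
        using that by (simp add: lessThan_atLeast0 sum_diff_nat_ivl)
      moreover have "vabs (\<Sum>i=m..<n. f i) \<le> e / 2"
        using that \<open>e > 0\<close> N by (intro vabs_sum_le less_imp_le[OF N]) auto
      ultimately show ?thesis
        using \<open>e > 0\<close> by (simp add: dist_vabs vabs_minus_commute[of "\<Sum>i<m. f i"])
    qed
    have "dist (\<Sum>i<m. f i) (\<Sum>i<n. f i) < e" if "N \<le> m" "N \<le> n" for m n
      using half[of m n] half[of n m] that by (cases m n rule: linorder_le_cases)
        (auto simp: dist_commute)
    then show "\<exists>M. \<forall>m\<ge>M. \<forall>n\<ge>M. dist (\<Sum>i<m. f i) (\<Sum>i<n. f i) < e" by blast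
  qed
  then show ?thesis
    using compl unfolding complete_def summable_iff_convergent convergent_def by blast
qed

section \<open>The p-adic integers\<close>

lemma padic_integers_diff:
  fixes x y :: "'a::nonarchimedean_field"
  assumes "x \<in> padic_integers" "y \<in> padic_integers"
  shows "x - y \<in> padic_integers"
proof -
  obtain f g where "\<And>n. f n \<in> \<rat>" "f \<longlonglongrightarrow> x" "\<And>n. g n \<in> \<rat>" "g \<longlonglongrightarrow> y"
    using assms unfolding padic_integers_def padic_numbers_def closure_sequential by blast
  then have "\<And>n. f n - g n \<in> \<rat>" "(\<lambda>n. f n - g n) \<longlonglongrightarrow> x - y"
    by (auto intro: tendsto_diff)
  then have "x - y \<in> closure \<rat>"
    unfolding closure_sequential by (intro exI[of _ "\<lambda>n. f n - g n"]) auto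
  then show ?thesis
    using vabs_diff_le_max[of x y] assms by (auto simp: padic_integers_def padic_numbers_def)
qed

lemma padic_integers_of_nat [simp]: "of_nat n \<in> (padic_integers :: 'a::nonarchimedean_field set)"
  unfolding padic_integers_def padic_numbers_def
  by (auto intro: subsetD[OF closure_subset] vabs_of_nat_le_1)

lemma padic_integers_0 [simp]: "0 \<in> (padic_integers :: 'a::nonarchimedean_field set)"
  using padic_integers_of_nat[of 0] by (simp del: padic_integers_of_nat)

lemma padic_integers_1 [simp]: "1 \<in> (padic_integers :: 'a::nonarchimedean_field set)"
  using padic_integers_of_nat[of 1] by (simp del: padic_integers_of_nat)

lemma padic_integers_minus:
  "x \<in> padic_integers \<Longrightarrow> - x \<in> (padic_integers :: 'a::nonarchimedean_field set)"
  using padic_integers_diff[of 0 x] by simp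

lemma padic_integers_add:
  fixes x y :: "'a::nonarchimedean_field"
  shows "x \<in> padic_integers \<Longrightarrow> y \<in> padic_integers \<Longrightarrow> x + y \<in> padic_integers"
  using padic_integers_diff[of x "- y"] padic_integers_minus[of y] by simp

lemma closed_padic_integers: "closed (padic_integers :: 'a::nonarchimedean_field set)"
proof -
  have eq: "(padic_integers :: 'a set) = closure \<rat> \<inter> {x. vabs x \<le> 1}"
    by (auto simp: padic_integers_def padic_numbers_def)
  have "closed {x :: 'a. vabs x \<le> 1}"
    by (intro closed_Collect_le continuous_intros)
  then show ?thesis
    unfolding eq by (intro closed_Int closed_closure)
qed

text \<open>
  Completeness makes series with terms tending to zero converge. The absolute value of \<open>p\<close>, which
  is prime, determines that of every integer, hence the topology in which the natural numbers are
  dense in the p-adic integers. The parameter \<open>K\<close> only names the type.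
\<close>

locale padic_ambient =
  fixes K :: "'a::nonarchimedean_field itself" and p :: nat
  assumes prime: "prime p"
    and complete_UNIV: "complete (UNIV :: 'a set)"
    and vabs_prime: "vabs (of_nat p :: 'a) = 1 / real p"
begin

lemma p_gt_1: "1 < p"
  using prime by (rule prime_gt_1_nat)

lemma inverse_power_small:
  assumes "0 < e" obtains k where "(1 / real p) ^ k < e"
  using real_arch_pow_inv[OF assms, of "1 / real p"] p_gt_1 by auto

lemma vabs_of_int_dvd:
  assumes "int p ^ k dvd m"
  shows "vabs (of_int m :: 'a) \<le> (1 / real p) ^ k"
proof -
  obtain l where m: "m = int p ^ k * l" using assms by blast
  have "vabs (of_int m :: 'a) = (1 / real p) ^ k * vabs (of_int l :: 'a)"
    by (simp add: m vabs_mult vabs_power vabs_prime)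
  then show ?thesis
    using vabs_of_int_le_1[of l, where 'a = 'a] by (simp add: mult_left_le)
qed

lemma vabs_of_nat_dvd:
  "p ^ k dvd n \<Longrightarrow> vabs (of_nat n :: 'a) \<le> (1 / real p) ^ k"
  using vabs_of_int_dvd[of k "int n"] by (metis of_int_of_nat_eq of_nat_dvd_iff of_nat_power)

lemma vabs_of_int_less_1:
  assumes "int p dvd m"
  shows "vabs (of_int m :: 'a) < 1"
proof -
  have "vabs (of_int m :: 'a) \<le> 1 / real p" using vabs_of_int_dvd[of 1 m] assms by simp
  also have "\<dots> < 1" using p_gt_1 by simp
  finally show ?thesis .
qed

text \<open>
  If \<open>p\<close> does not divide \<open>b\<close>, then \<open>u b + v p = 1\<close> for some integers, and an absolute value of
  \<open>b\<close> below 1 would make the left side smaller than 1.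
\<close>

lemma vabs_of_int_not_dvd:
  assumes "\<not> int p dvd b"
  shows "vabs (of_int b :: 'a) = 1"
proof (rule ccontr)
  assume "vabs (of_int b :: 'a) \<noteq> 1"
  then have less: "vabs (of_int b :: 'a) < 1" using vabs_of_int_le_1[of b, where 'a = 'a] by simp
  have "coprime b (int p)"
    using assms prime by (metis coprime_commute prime_imp_coprime prime_nat_int_transfer)
  then obtain u v where uv: "u * b + v * int p = 1"
    by (metis bezout_int coprime_iff_gcd_eq_1)
  have "vabs (of_int (u * b) :: 'a) < 1"
    using less vabs_of_int_le_1[of u, where 'a = 'a]
    by (simp add: vabs_mult) (meson le_less_trans mult_left_le_one_le vabs_nonneg)
  moreover have "vabs (of_int (v * int p) :: 'a) < 1"
    by (rule vabs_of_int_less_1) simp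
  moreover have "vabs (of_int (u * b + v * int p) :: 'a) = 1" unfolding uv by simp
  ultimately show False
    using vabs_add_le_max[of "of_int (u * b) :: 'a" "of_int (v * int p)"]
    by (simp only: of_int_add)
qed

text \<open>
  A p-adic integer is a limit of rational numbers of absolute value at most 1. Such a number has a
  denominator prime to \<open>p\<close>, so modulo \<open>p ^ k\<close> it is congruent to an integer in \<open>{0..<p ^ k}\<close>.
\<close>

lemma padic_integer_approx:
  fixes x :: 'a
  assumes x: "x \<in> padic_integers"
  obtains n where "n < p ^ k" "vabs (x - of_nat n) \<le> (1 / real p) ^ k"
proof -
  have pos: "(1 / real p) ^ k > 0" and le1: "(1 / real p) ^ k \<le> 1"
    using p_gt_1 by (auto intro: power_le_one)
  obtain r :: 'a where r: "r \<in> \<rat>" "dist r x < (1 / real p) ^ k"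
    using x pos unfolding padic_integers_def padic_numbers_def closure_approachable by blast
  have xr: "vabs (x - r) < (1 / real p) ^ k"
    using r(2) by (simp add: dist_vabs vabs_minus_commute[of x])
  have "vabs r \<le> 1"
    using vabs_diff_le_max[of x "x - r"] xr le1 x by (auto simp: padic_integers_def)
  obtain a b where b: "b > 0" and cop: "coprime a b" and rab: "r = of_int a / of_int b"
    using r(1) Rats_cases' by metis
  have nb: "\<not> int p dvd b"
  proof
    assume pb: "int p dvd b"
    then have "\<not> int p dvd a"
      using cop p_gt_1 by (metis coprime_common_divisor int_ops(2) less_irrefl not_prime_unit prime prime_nat_int_transfer)
    then have "vabs (of_int a :: 'a) = 1" by (rule vabs_of_int_not_dvd)
    moreover have "vabs (of_int b :: 'a) < 1"
      using pb by (rule vabs_of_int_less_1)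
    moreover have "vabs (of_int b :: 'a) > 0" using b by (simp add: less_le)
    ultimately have "vabs r > 1" by (simp add: rab vabs_divide)
    with \<open>vabs r \<le> 1\<close> show False by simp
  qed
  then have "coprime b (int p ^ k)"
    using prime by (metis coprime_commute coprime_power_right_iff prime_imp_coprime prime_nat_int_transfer)
  then obtain u v where uv: "u * b + v * int p ^ k = 1"
    by (metis bezout_int coprime_iff_gcd_eq_1)
  define m where "m = (a * u) mod int p ^ k"
  have m: "0 \<le> m" "m < int p ^ k" using p_gt_1 by (auto simp: m_def)
  obtain w where "a * u = int p ^ k * w + m"
    unfolding m_def using mult_div_mod_eq by metis
  then have m_eq: "m = a * u - int p ^ k * w" by linarith
  have "a - b * m = a * (1 - u * b) + int p ^ k * (b * w)"
    unfolding m_eq by (simp add: algebra_simps)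
  also have "1 - u * b = v * int p ^ k" using uv by linarith
  finally have "int p ^ k dvd a - b * m" by simp
  then have "vabs (of_int (a - b * m) :: 'a) \<le> (1 / real p) ^ k" by (rule vabs_of_int_dvd)
  moreover have "r - of_int m = of_int (a - b * m) / of_int b"
    using b by (simp add: rab field_simps)
  ultimately have "vabs (r - of_int m) \<le> (1 / real p) ^ k"
    by (simp add: vabs_divide vabs_of_int_not_dvd[OF nb])
  then have "vabs (x - of_int m) \<le> (1 / real p) ^ k"
    using vabs_add_le_max[of "x - r" "r - of_int m"] xr by simp
  with m show thesis by (intro that[of "nat m"]) (auto simp: nat_less_iff)
qed

lemma padic_integers_eq_closure: "(padic_integers :: 'a set) = closure (range of_nat)"
proof
  show "closure (range of_nat) \<subseteq> (padic_integers :: 'a set)"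
    by (intro closure_minimal closed_padic_integers) auto
  show "(padic_integers :: 'a set) \<subseteq> closure (range of_nat)"
  proof
    fix x :: 'a assume x: "x \<in> padic_integers"
    show "x \<in> closure (range of_nat)"
      unfolding closure_approachable
    proof (intro allI impI)
      fix e :: real assume "e > 0"
      then obtain k where k: "(1 / real p) ^ k < e" by (rule inverse_power_small)
      obtain n where "vabs (x - of_nat n) \<le> (1 / real p) ^ k"
        using padic_integer_approx[OF x] by blast
      with k show "\<exists>y\<in>range of_nat. dist y x < e"
        by (intro bexI[of _ "of_nat n"]) (auto simp: dist_vabs vabs_minus_commute[of _ x])
    qed
  qed
qed

text \<open>
  The residues modulo \<open>p ^ k\<close> form a finite net, so the p-adic integers are totally bounded.
\<close>

lemma compact_padic_integers: "compact (padic_integers :: 'a set)"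
  unfolding compact_eq_totally_bounded
proof (intro conjI allI impI)
  show "complete (padic_integers :: 'a set)"
    using complete_UNIV closed_padic_integers complete_closed_subset by blast
next
  fix e :: real assume "e > 0"
  then obtain k where k: "(1 / real p) ^ k < e" by (rule inverse_power_small)
  show "\<exists>S. finite S \<and> (padic_integers :: 'a set) \<subseteq> (\<Union>x\<in>S. ball x e)"
  proof (intro exI conjI subsetI)
    fix x :: 'a assume x: "x \<in> padic_integers"
    obtain n where "n < p ^ k" "vabs (x - of_nat n) \<le> (1 / real p) ^ k"
      using padic_integer_approx[OF x] by blast
    with k show "x \<in> (\<Union>y\<in>of_nat ` {..<p ^ k}. ball y e)"
      by (intro UN_I[of "of_nat n"]) (auto simp: dist_vabs vabs_minus_commute[of _ x])
  qed simp
qed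

lemma eq_on_padic_integers:
  fixes f g :: "'a \<Rightarrow> 'a"
  assumes "continuous_on padic_integers f" "continuous_on padic_integers g"
    and eq: "\<And>n. f (of_nat n) = g (of_nat n)" and x: "x \<in> padic_integers"
  shows "f x = g x"
proof -
  have "continuous_on (closure (range of_nat)) (\<lambda>x. f x - g x)"
    unfolding padic_integers_eq_closure[symmetric] by (intro continuous_intros assms)
  then have "f x - g x = 0"
    by (rule continuous_constant_on_closure)
       (use eq x padic_integers_eq_closure in auto)
  then show ?thesis by simp
qed

text \<open>Every \<open>p\<close> consecutive factors of a factorial contribute a factor \<open>p\<close>.\<close>

lemma fact_tendsto_0: "(\<lambda>n. fact n :: 'a) \<longlonglongrightarrow> 0"
proof -
  have dvd: "p ^ k dvd fact (p * k)" for k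
  proof (induction k)
    case (Suc k)
    obtain m where m: "p * Suc k = Suc m" using p_gt_1 by (cases "p * Suc k") auto
    with p_gt_1 have "p * k \<le> m" by simp
    then have "p ^ k dvd fact m" using Suc fact_dvd dvd_trans by blast
    then have "p ^ Suc k dvd p * Suc k * fact m" by (simp add: mult_dvd_mono)
    then show ?case by (simp only: m fact_Suc of_nat_id)
  qed simp
  show ?thesis unfolding LIMSEQ_def
  proof (intro allI impI)
    fix e :: real assume "e > 0"
    then obtain k where k: "(1 / real p) ^ k < e" by (rule inverse_power_small)
    have "dist (fact n :: 'a) 0 < e" if "n \<ge> p * k" for n
    proof -
      have "p ^ k dvd fact n" using dvd[of k] fact_dvd[OF that] dvd_trans by blast
      then have "vabs (of_nat (fact n) :: 'a) \<le> (1 / real p) ^ k" by (rule vabs_of_nat_dvd)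
      with k show ?thesis by (simp add: dist_0_vabs)
    qed
    then show "\<exists>N. \<forall>n\<ge>N. dist (fact n :: 'a) 0 < e" by blast
  qed
qed

end

section \<open>Mahler series\<close>

definition mahler_series :: "(nat \<Rightarrow> 'a::nonarchimedean_field) \<Rightarrow> 'a \<Rightarrow> 'a" where
  "mahler_series c = (\<lambda>x\<in>padic_integers. \<Sum>n. c n * (x gchoose n))"

lemma continuous_on_gbinomial [continuous_intros]:
  fixes f :: "'b::topological_space \<Rightarrow> 'a::nonarchimedean_field"
  assumes "continuous_on A f"
  shows "continuous_on A (\<lambda>x. f x gchoose n)"
proof (induction n)
  case (Suc n)
  have "(f x gchoose Suc n) = (f x - of_nat n) * (f x gchoose n) * (1 / of_nat (Suc n))" for x
    using gbinomial_absorb_comp[of "f x" n] gbinomial_absorption[of n "f x"]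
    by (simp add: field_simps del: of_nat_Suc)
  then show ?case
    by (simp only:) (intro continuous_intros continuous_on_mult' assms Suc)
qed simp

lemma sums_Suc_iff_nonarch:
  fixes f :: "nat \<Rightarrow> 'a::nonarchimedean_field"
  assumes "f 0 = 0"
  shows "f sums s \<longleftrightarrow> (\<lambda>n. f (Suc n)) sums s"
proof -
  have "(\<Sum>i<Suc n. f i) = (\<Sum>i<n. f (Suc i))" for n
    unfolding sum.lessThan_Suc_shift assms by simp
  then show ?thesis
    unfolding sums_def by (subst filterlim_sequentially_Suc[symmetric]) simp
qed

context padic_ambient
begin

text \<open>This holds for natural numbers, where binomials are integers, and they are dense.\<close>

lemma vabs_gbinomial_le_1:
  fixes x :: 'a
  assumes "x \<in> padic_integers"
  shows "vabs (x gchoose n) \<le> 1"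
proof -
  have "closure (range of_nat) \<subseteq> {x :: 'a. vabs (x gchoose n) \<le> 1}"
    by (intro closure_minimal closed_Collect_le continuous_intros)
       (auto simp: binomial_gbinomial[symmetric] vabs_of_nat_le_1)
  with assms show ?thesis by (auto simp: padic_integers_eq_closure)
qed

lemma sums_mahler_series:
  fixes c :: "nat \<Rightarrow> 'a"
  assumes "c \<longlonglongrightarrow> 0" and x: "x \<in> padic_integers"
  shows "(\<lambda>n. c n * (x gchoose n)) sums mahler_series c x"
proof -
  have "(\<lambda>n. c n * (x gchoose n)) \<longlonglongrightarrow> 0"
    using assms by (intro tendsto_0_mult_bounded[where B = 1] vabs_gbinomial_le_1)
  then have "summable (\<lambda>n. c n * (x gchoose n))"
    by (rule summable_nonarch[OF complete_UNIV])
  then show ?thesis using x by (simp add: mahler_series_def summable_sums)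
qed

lemma mahler_series_eqI:
  fixes c :: "nat \<Rightarrow> 'a"
  assumes "(\<lambda>n. c n * (x gchoose n)) sums s" and "x \<in> padic_integers"
  shows "mahler_series c x = s"
  using assms sums_unique by (force simp: mahler_series_def)

lemma mahler_series_extensional: "mahler_series c \<in> extensional padic_integers"
  by (simp add: mahler_series_def)

lemma vabs_mahler_series_le:
  fixes c :: "nat \<Rightarrow> 'a"
  assumes "c \<longlonglongrightarrow> 0" "x \<in> padic_integers" "\<And>n. vabs (c n) \<le> B"
  shows "vabs (mahler_series c x) \<le> B"
proof (rule vabs_sums_le)
  show "(\<lambda>n. c n * (x gchoose n)) sums mahler_series c x" by (rule sums_mahler_series) fact+
  show "vabs (c n * (x gchoose n)) \<le> B" for n
    using assms(3)[of n] mult_left_le[OF vabs_gbinomial_le_1[OF assms(2), of n] vabs_nonneg[of "c n"]]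
    by (simp add: vabs_mult)
qed

lemma mahler_series_diff:
  fixes c d :: "nat \<Rightarrow> 'a"
  assumes "c \<longlonglongrightarrow> 0" "d \<longlonglongrightarrow> 0" "x \<in> padic_integers"
  shows "mahler_series (\<lambda>n. c n - d n) x = mahler_series c x - mahler_series d x"
  by (rule mahler_series_eqI)
     (use sums_diff_nonarch[OF sums_mahler_series[OF assms(1,3)] sums_mahler_series[OF assms(2,3)]]
       assms(3) in \<open>simp_all add: algebra_simps\<close>)

lemma mahler_series_scale:
  fixes c :: "nat \<Rightarrow> 'a"
  assumes "c \<longlonglongrightarrow> 0" "x \<in> padic_integers"
  shows "mahler_series (\<lambda>n. a * c n) x = a * mahler_series c x"
  by (rule mahler_series_eqI)
     (use sums_mult_const[OF sums_mahler_series[OF assms], of a] assms(2)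
       in \<open>simp_all add: algebra_simps\<close>)

lemma mahler_series_sum:
  fixes c :: "'i \<Rightarrow> nat \<Rightarrow> 'a"
  assumes "\<And>i. i \<in> I \<Longrightarrow> c i \<longlonglongrightarrow> 0" "x \<in> padic_integers"
  shows "mahler_series (\<lambda>n. \<Sum>i\<in>I. c i n) x = (\<Sum>i\<in>I. mahler_series (c i) x)"
  by (rule mahler_series_eqI)
     (use sums_sum[of I "\<lambda>i n. c i n * (x gchoose n)", OF sums_mahler_series[OF assms]] assms(2)
       in \<open>simp_all add: sum_distrib_right\<close>)

text \<open>
  Binomials are bounded by 1 on the p-adic integers, so the tail of the series is bounded by
  the supremum of the remaining coefficients, uniformly in the argument.
\<close>

lemma uniform_limit_mahler_series:
  fixes c :: "nat \<Rightarrow> 'a"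
  assumes c: "c \<longlonglongrightarrow> 0"
  shows "uniform_limit padic_integers (\<lambda>N x. \<Sum>n<N. c n * (x gchoose n)) (mahler_series c) sequentially"
  unfolding uniform_limit_sequentially_iff
proof (intro allI impI)
  fix e :: real assume "e > 0"
  then obtain N where N: "\<And>n. n \<ge> N \<Longrightarrow> vabs (c n) < e / 2"
    using c unfolding LIMSEQ_def by (metis dist_0_vabs half_gt_zero)
  have "dist (\<Sum>n<M. c n * (x gchoose n)) (mahler_series c x) < e"
    if M: "M \<ge> N" and x: "x \<in> padic_integers" for M x
  proof -
    have "(\<lambda>n. (if n \<in> {..<M} then c n * (x gchoose n) else 0)) sums (\<Sum>n<M. c n * (x gchoose n))"
      by (rule sums_If_finite_set) simp
    from sums_diff_nonarch[OF this sums_mahler_series[OF c x]]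
    have "vabs ((\<Sum>n<M. c n * (x gchoose n)) - mahler_series c x) \<le> e / 2"
    proof (rule vabs_sums_le)
      fix n
      have "vabs (c n) * vabs (x gchoose n) \<le> vabs (c n)"
        by (rule mult_left_le[OF vabs_gbinomial_le_1[OF x] vabs_nonneg])
      then show "vabs ((if n \<in> {..<M} then c n * (x gchoose n) else 0) - c n * (x gchoose n)) \<le> e / 2"
        using N[of n] M \<open>e > 0\<close> by (auto simp: vabs_mult)
    qed
    with \<open>e > 0\<close> show ?thesis by (simp add: dist_vabs)
  qed
  then show "\<exists>N. \<forall>M\<ge>N. \<forall>x\<in>padic_integers.
      dist (\<Sum>n<M. c n * (x gchoose n)) (mahler_series c x) < e"
    by blast
qed

lemma mahler_series_padic_cont:
  fixes c :: "nat \<Rightarrow> 'a"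
  assumes "c \<longlonglongrightarrow> 0"
  shows "mahler_series c \<in> padic_cont"
proof -
  have "continuous_on padic_integers (mahler_series c)"
    using uniform_limit_mahler_series[OF assms]
    by (rule uniform_limit_theorem[rotated]) (auto intro!: always_eventually continuous_intros)
  then show ?thesis by (simp add: padic_cont_def mahler_series_extensional)
qed

text \<open>Pascal's rule says that the forward difference shifts the coefficients.\<close>

lemma nabla_mahler_series:
  fixes c :: "nat \<Rightarrow> 'a"
  assumes c: "c \<longlonglongrightarrow> 0"
  shows "nabla (mahler_series c) = mahler_series (\<lambda>n. c (Suc n))"
proof
  fix x :: 'a
  show "nabla (mahler_series c) x = mahler_series (\<lambda>n. c (Suc n)) x"
  proof (cases "x \<in> padic_integers")
    case x: True
    have x1: "x + 1 \<in> padic_integers" using x by (intro padic_integers_add) auto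
    have "(\<lambda>n. c n * (x + 1 gchoose n) - c n * (x gchoose n)) sums
            (mahler_series c (x + 1) - mahler_series c x)"
      by (intro sums_diff_nonarch sums_mahler_series c x x1)
    then have "(\<lambda>n. c (Suc n) * (x + 1 gchoose Suc n) - c (Suc n) * (x gchoose Suc n)) sums
            (mahler_series c (x + 1) - mahler_series c x)"
      by (subst (asm) sums_Suc_iff_nonarch) simp_all
    then have "(\<lambda>n. c (Suc n) * (x gchoose n)) sums (mahler_series c (x + 1) - mahler_series c x)"
      by (simp add: gbinomial_Suc_Suc ring_distribs)
    then show ?thesis using x by (simp add: mahler_series_eqI nabla_def)
  qed (simp add: nabla_def mahler_series_def)
qed

lemma nabla_power_mahler_series:
  fixes c :: "nat \<Rightarrow> 'a"
  assumes c: "c \<longlonglongrightarrow> 0"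
  shows "(nabla ^^ m) (mahler_series c) = mahler_series (\<lambda>n. c (n + m))"
proof (induction m)
  case (Suc m)
  have "(\<lambda>n. c (n + m)) \<longlonglongrightarrow> 0" using c by (rule LIMSEQ_ignore_initial_segment)
  then show ?case by (simp add: Suc nabla_mahler_series)
qed simp

lemma mahler_series_at_0:
  fixes c :: "nat \<Rightarrow> 'a"
  shows "mahler_series c 0 = c 0"
proof (rule mahler_series_eqI)
  show "(\<lambda>n. c n * (0 gchoose n)) sums c 0"
    using sums_finite[of "{0}" "\<lambda>n. c n * (0 gchoose n)"] by (simp add: gbinomial_0_left)
qed simp

text \<open>Mahler coefficients are iterated differences at 0, so the sum of the series determines them.\<close>

lemma mahler_coefficient:
  fixes c :: "nat \<Rightarrow> 'a"
  assumes "c \<longlonglongrightarrow> 0"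
  shows "(nabla ^^ n) (mahler_series c) 0 = c n"
  by (simp add: nabla_power_mahler_series assms mahler_series_at_0)

lemma mahler_series_inj:
  fixes c d :: "nat \<Rightarrow> 'a"
  assumes "c \<longlonglongrightarrow> 0" "d \<longlonglongrightarrow> 0" "mahler_series c = mahler_series d"
  shows "c = d"
  using mahler_coefficient assms by (metis ext)

text \<open>
  The absorption identity \<open>x (x - 1 choose n) = (n + 1) (x choose n + 1)\<close> turns multiplication by
  \<open>x\<close> after a backward shift into an operation on coefficients.
\<close>

lemma S_op_mahler_series:
  fixes c :: "nat \<Rightarrow> 'a"
  assumes c: "c \<longlonglongrightarrow> 0"
  shows "S_op (mahler_series c) = mahler_series (\<lambda>n. c n - of_nat n * c (n - 1))"
proof
  fix x :: 'a
  show "S_op (mahler_series c) x = mahler_series (\<lambda>n. c n - of_nat n * c (n - 1)) x"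
  proof (cases "x \<in> padic_integers")
    case x: True
    have x1: "x - 1 \<in> padic_integers" using x by (intro padic_integers_diff) auto
    have "x * (c n * (x - 1 gchoose n)) = of_nat (Suc n) * c n * (x gchoose Suc n)" for n
      by (metis gbinomial_absorption mult.assoc mult.commute)
    then have "(\<lambda>n. of_nat (Suc n) * c n * (x gchoose Suc n)) sums (x * mahler_series c (x - 1))"
      using sums_mult_const[OF sums_mahler_series[OF c x1], of x] by (simp only:)
    then have "(\<lambda>n. of_nat n * c (n - 1) * (x gchoose n)) sums (x * mahler_series c (x - 1))"
      by (subst sums_Suc_iff_nonarch) auto
    from sums_diff_nonarch[OF sums_mahler_series[OF c x] this]
    have "(\<lambda>n. (c n - of_nat n * c (n - 1)) * (x gchoose n)) sums
            (mahler_series c x - x * mahler_series c (x - 1))"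
      by (simp add: algebra_simps)
    then show ?thesis using x by (simp add: mahler_series_eqI S_op_def)
  qed (simp add: S_op_def mahler_series_def)
qed

end

section \<open>Mahler's theorem\<close>

text \<open>
  From \<open>j (p^t choose j) = p^t (p^t - 1 choose j - 1)\<close>: if the binomial were prime to \<open>p\<close>, then
  \<open>p^t\<close> would divide \<open>j\<close>.
\<close>

lemma prime_dvd_prime_power_choose:
  fixes p :: nat
  assumes "prime p" "0 < j" "j < p ^ t"
  shows "p dvd (p ^ t choose j)"
proof (rule ccontr)
  assume "\<not> p dvd (p ^ t choose j)"
  then have "coprime (p ^ t) (p ^ t choose j)"
    using assms(1) by (simp add: prime_imp_coprime)
  moreover have "j * (p ^ t choose j) = p ^ t * (p ^ t - 1 choose (j - 1))"
    using binomial_absorption[of "j - 1" "p ^ t"] assms(2) by simp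
  then have "p ^ t dvd j * (p ^ t choose j)" by simp
  ultimately have "p ^ t dvd j" by (simp add: coprime_dvd_mult_left_iff)
  with assms(2,3) show False by (meson dvd_imp_le not_le)
qed

lemma nabla_power_Suc:
  "x \<in> padic_integers \<Longrightarrow> (nabla ^^ Suc m) f x = (nabla ^^ m) f (x + 1) - (nabla ^^ m) f x"
  by (simp add: nabla_def)

text \<open>Newton's forward difference formula, for an arbitrary difference of \<open>f\<close>.\<close>

lemma nabla_power_at_nat:
  fixes f :: "'a::nonarchimedean_field \<Rightarrow> 'a"
  shows "(nabla ^^ m) f (of_nat n) = (\<Sum>j\<le>n. of_nat (n choose j) * (nabla ^^ (m + j)) f 0)"
proof (induction n arbitrary: m)
  case (Suc n)
  have "(nabla ^^ m) f (of_nat (Suc n)) = (nabla ^^ m) f (of_nat n) + (nabla ^^ Suc m) f (of_nat n)"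
    by (simp add: nabla_power_Suc add.commute del: funpow.simps)
  also have "\<dots> = (\<Sum>j\<le>n. of_nat (n choose j) * (nabla ^^ (m + j)) f 0)
                 + (\<Sum>j\<le>n. of_nat (n choose j) * (nabla ^^ (m + Suc j)) f 0)"
    by (simp only: Suc.IH add_Suc add_Suc_right)
  also have "(\<Sum>j\<le>n. of_nat (n choose j) * (nabla ^^ (m + j)) f 0)
      = (\<Sum>j\<le>Suc n. of_nat (n choose j) * (nabla ^^ (m + j)) f 0)" by simp
  also have "\<dots> = (nabla ^^ m) f 0 + (\<Sum>j\<le>n. of_nat (n choose Suc j) * (nabla ^^ (m + Suc j)) f 0)"
    by (subst sum.atMost_Suc_shift) simp
  also have "\<dots> + (\<Sum>j\<le>n. of_nat (n choose j) * (nabla ^^ (m + Suc j)) f 0)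
      = (nabla ^^ m) f 0 + (\<Sum>j\<le>n. of_nat (Suc n choose Suc j) * (nabla ^^ (m + Suc j)) f 0)"
    by (simp add: sum.distrib[symmetric] ring_distribs add.commute)
  also have "\<dots> = (\<Sum>j\<le>Suc n. of_nat (Suc n choose j) * (nabla ^^ (m + j)) f 0)"
    by (simp add: sum.atMost_Suc_shift del: sum.atMost_Suc)
  finally show ?case .
qed simp

text \<open>
  Taking differences commutes with translations and, by the ultrametric inequality, does not
  increase upper bounds.
\<close>

lemma vabs_nabla_power_translate_le:
  fixes f :: "'a::nonarchimedean_field \<Rightarrow> 'a"
  assumes "\<And>x. x \<in> padic_integers \<Longrightarrow> vabs (f (x + h) - f x) \<le> e"
    and h: "h \<in> padic_integers" and "x \<in> padic_integers"
  shows "vabs ((nabla ^^ m) f (x + h) - (nabla ^^ m) f x) \<le> e"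
  using assms(3)
proof (induction m arbitrary: x)
  case (Suc m)
  let ?g = "(nabla ^^ m) f"
  have x: "x + h \<in> padic_integers" "x + 1 \<in> padic_integers"
    using Suc.prems h by (auto intro: padic_integers_add)
  have "(nabla ^^ Suc m) f (x + h) - (nabla ^^ Suc m) f x
      = (?g (x + 1 + h) - ?g (x + 1)) - (?g (x + h) - ?g x)"
    using x Suc.prems by (simp add: nabla_power_Suc algebra_simps del: funpow.simps)
  then show ?case
    using vabs_diff_le_max[of "?g (x + 1 + h) - ?g (x + 1)" "?g (x + h) - ?g x"]
      Suc.IH[OF x(2)] Suc.IH[OF Suc.prems] by simp
qed (use assms(1) in simp)

lemma vabs_nabla_power_le:
  fixes f :: "'a::nonarchimedean_field \<Rightarrow> 'a"
  assumes "\<And>x. x \<in> padic_integers \<Longrightarrow> vabs (f x) \<le> B" and "x \<in> padic_integers"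
  shows "vabs ((nabla ^^ m) f x) \<le> B"
  using assms(2)
proof (induction m arbitrary: x)
  case (Suc m)
  have x1: "x + 1 \<in> padic_integers" using Suc.prems by (auto intro: padic_integers_add)
  show ?case
    using vabs_diff_le_max[of "(nabla ^^ m) f (x + 1)" "(nabla ^^ m) f x"]
      Suc.IH[OF x1] Suc.IH[OF Suc.prems] Suc.prems by (simp add: nabla_power_Suc del: funpow.simps)
qed (use assms(1) in simp)

context padic_ambient
begin

lemma padic_cont_bounded:
  fixes f :: "'a \<Rightarrow> 'a"
  assumes "f \<in> padic_cont"
  obtains B where "0 \<le> B" "\<And>x. x \<in> padic_integers \<Longrightarrow> vabs (f x) \<le> B"
proof -
  have "compact (f ` padic_integers)"
    using assms compact_padic_integers by (intro compact_continuous_image) (auto simp: padic_cont_def)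
  then have "bounded (f ` padic_integers)" by (rule compact_imp_bounded)
  then obtain B where B: "\<And>x. x \<in> padic_integers \<Longrightarrow> dist 0 (f x) \<le> B"
    unfolding bounded_any_center[where a = 0] by auto
  have "vabs (f x) \<le> B" if "x \<in> padic_integers" for x
    using B[OF that] unfolding dist_commute[of 0] dist_0_vabs .
  moreover from this[of 0] have "0 \<le> B" using vabs_nonneg order_trans padic_integers_0 by blast
  ultimately show thesis using that by blast
qed

text \<open>
  This is Bojanic's argument. By uniform continuity a shift by \<open>p ^ t\<close> changes \<open>f\<close>, and hence every
  difference of \<open>f\<close>, by at most \<open>e\<close>. Newton's formula writes this change as the difference of
  order \<open>m + p ^ t\<close> at 0 plus multiples of lower ones by binomial coefficients divisible by \<open>p\<close>.
  So each step of length \<open>p ^ t\<close> improves the bound on the differences at 0 by a factor \<open>1 / p\<close>,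
  until it reaches \<open>e\<close>.
\<close>

lemma nabla_power_at_0_tendsto_0:
  fixes f :: "'a \<Rightarrow> 'a"
  assumes f: "f \<in> padic_cont"
  shows "(\<lambda>n. (nabla ^^ n) f 0) \<longlonglongrightarrow> 0"
  unfolding LIMSEQ_def
proof (intro allI impI)
  fix e' :: real assume "e' > 0"
  define e where "e = e' / 2"
  have e: "0 < e" "e < e'" using \<open>e' > 0\<close> by (auto simp: e_def)
  let ?c = "\<lambda>n. (nabla ^^ n) f 0"
  obtain B where B: "0 \<le> B" "\<And>x. x \<in> padic_integers \<Longrightarrow> vabs (f x) \<le> B"
    using padic_cont_bounded[OF f] by blast
  have "uniformly_continuous_on padic_integers f"
    using f compact_padic_integers by (auto simp: padic_cont_def intro: compact_uniformly_continuous)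
  then obtain d where d: "0 < d" "\<And>x y. x \<in> padic_integers \<Longrightarrow> y \<in> padic_integers \<Longrightarrow>
      dist y x < d \<Longrightarrow> dist (f y) (f x) < e"
    using e(1) unfolding uniformly_continuous_on_def by metis
  obtain t where t: "(1 / real p) ^ t < d" using d(1) by (rule inverse_power_small)
  define N where "N = p ^ t"
  have N: "0 < N" using p_gt_1 by (simp add: N_def)
  have "vabs (f (x + of_nat N) - f x) \<le> e" if x: "x \<in> padic_integers" for x
  proof -
    have "dist (x + of_nat N) x < d"
      using vabs_of_nat_dvd[of t N] t by (simp add: dist_vabs N_def)
    then show ?thesis
      using d(2)[OF x padic_integers_add[OF x padic_integers_of_nat]] by (force simp: dist_vabs)
  qed
  then have shift: "vabs ((nabla ^^ m) f (of_nat N) - ?c m) \<le> e" for m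
    using vabs_nabla_power_translate_le[of f "of_nat N" e 0 m] by simp
  have recursion: "?c (m + N) = ((nabla ^^ m) f (of_nat N) - ?c m)
      - (\<Sum>j\<in>{0<..<N}. of_nat (N choose j) * ?c (m + j))" for m
  proof -
    \<comment> \<open>Newton's formula with the terms \<open>j = 0\<close> and \<open>j = N\<close> split off\<close>
    have "{..N} = insert 0 (insert N {0<..<N})" using N by auto
    then show ?thesis using N by (simp add: nabla_power_at_nat)
  qed
  have bound: "vabs (?c n) \<le> max e ((1 / real p) ^ r * B)" if "n \<ge> r * N" for r n
    using that
  proof (induction r arbitrary: n)
    case 0
    show ?case using vabs_nabla_power_le[of f B 0 n] B by simp
  next
    case (Suc r)
    let ?M = "max e ((1 / real p) ^ Suc r * B)"
    define m where "m = n - N"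
    have n: "n = m + N" "m \<ge> r * N" using Suc.prems by (auto simp: m_def)
    have "vabs (of_nat (N choose j) * ?c (m + j)) \<le> ?M" if "j \<in> {0<..<N}" for j
    proof -
      have "p dvd N choose j"
        using that prime_dvd_prime_power_choose[OF prime, of j t] by (simp add: N_def)
      then have "vabs (of_nat (N choose j) :: 'a) \<le> 1 / real p"
        using vabs_of_nat_dvd[of 1 "N choose j"] by simp
      moreover have "vabs (?c (m + j)) \<le> max e ((1 / real p) ^ r * B)"
        using n(2) by (intro Suc.IH) simp
      ultimately have "vabs (of_nat (N choose j) * ?c (m + j))
          \<le> 1 / real p * max e ((1 / real p) ^ r * B)"
        unfolding vabs_mult by (intro mult_mono) auto
      also have "\<dots> = max (1 / real p * e) ((1 / real p) ^ Suc r * B)"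
        by (simp add: max_mult_distrib_left)
      also have "1 / real p * e \<le> e" using e(1) p_gt_1 by (simp add: field_simps)
      then have "max (1 / real p * e) ((1 / real p) ^ Suc r * B) \<le> ?M" by auto
      finally show ?thesis .
    qed
    then have "vabs (\<Sum>j\<in>{0<..<N}. of_nat (N choose j) * ?c (m + j)) \<le> ?M"
      using e(1) by (intro vabs_sum_le) auto
    moreover have "vabs ((nabla ^^ m) f (of_nat N) - ?c m) \<le> ?M" using shift[of m] by simp
    ultimately show ?case
      unfolding n(1) recursion by (rule order.trans[OF vabs_diff_le_max max.boundedI, rotated])
  qed
  have "\<exists>r. (1 / real p) ^ r * B < e"
  proof -
    obtain r where "(1 / real p) ^ r < e / (B + 1)"
      using inverse_power_small[of "e / (B + 1)"] e(1) B(1) by auto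
    then have "(1 / real p) ^ r * (B + 1) < e" using B(1) by (simp add: pos_less_divide_eq)
    moreover have "(1 / real p) ^ r * B \<le> (1 / real p) ^ r * (B + 1)"
      by (intro mult_left_mono) auto
    ultimately show ?thesis by (intro exI[of _ r]) linarith
  qed
  then obtain r where r: "(1 / real p) ^ r * B < e" by blast
  have "dist (?c n) 0 < e'" if "n \<ge> r * N" for n
    using bound[OF that] r e(2) unfolding dist_0_vabs by linarith
  then show "\<exists>no. \<forall>n\<ge>no. dist (?c n) 0 < e'" by blast
qed

text \<open>
  Both sides have the same differences at 0, hence by Newton's formula the same values on the
  natural numbers, which are dense.
\<close>

theorem Mahler:
  fixes f :: "'a \<Rightarrow> 'a"
  assumes f: "f \<in> padic_cont"
  shows "f = mahler_series (\<lambda>n. (nabla ^^ n) f 0)"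
proof
  fix x :: 'a
  let ?c = "\<lambda>n. (nabla ^^ n) f 0"
  have c: "?c \<longlonglongrightarrow> 0" by (rule nabla_power_at_0_tendsto_0[OF f])
  show "f x = mahler_series ?c x"
  proof (cases "x \<in> padic_integers")
    case True
    have cont: "continuous_on padic_integers f" "continuous_on padic_integers (mahler_series ?c)"
      using f mahler_series_padic_cont[OF c] by (simp_all add: padic_cont_def)
    have "f (of_nat n) = mahler_series ?c (of_nat n)" for n
      using nabla_power_at_nat[of 0 f n] nabla_power_at_nat[of 0 "mahler_series ?c" n]
      by (simp add: mahler_coefficient[OF c])
    then show ?thesis
      using True by (rule eq_on_padic_integers[OF cont])
  next
    case False
    then show ?thesis using f by (simp add: padic_cont_def extensional_def mahler_series_def)
  qed
qed

end

section \<open>The operators S and I in terms of Mahler coefficients\<close>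

context padic_ambient
begin

text \<open>The coefficients \<open>c\<^sub>n - n c\<^sub>n\<^sub>-\<^sub>1\<close> of \<open>S_op f\<close> determine those of \<open>f\<close> recursively.\<close>

lemma S_op_inj: "inj_on S_op (padic_cont :: ('a \<Rightarrow> 'a) set)"
proof (rule inj_onI)
  fix f g :: "'a \<Rightarrow> 'a"
  assume f: "f \<in> padic_cont" and g: "g \<in> padic_cont" and eq: "S_op f = S_op g"
  obtain c where c: "c \<longlonglongrightarrow> 0" "f = mahler_series c"
    using nabla_power_at_0_tendsto_0[OF f] Mahler[OF f] by blast
  obtain d where d: "d \<longlonglongrightarrow> 0" "g = mahler_series d"
    using nabla_power_at_0_tendsto_0[OF g] Mahler[OF g] by blast
  have lim: "(\<lambda>n. b n - of_nat n * b (n - 1)) \<longlonglongrightarrow> 0" if b: "b \<longlonglongrightarrow> (0 :: 'a)" for b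
  proof -
    have "(\<lambda>n. b n * of_nat (Suc n)) \<longlonglongrightarrow> 0"
      using b vabs_of_nat_le_1 by (rule tendsto_0_mult_bounded)
    then have "(\<lambda>n. of_nat n * b (n - 1)) \<longlonglongrightarrow> 0"
      by (subst filterlim_sequentially_Suc[symmetric]) (simp add: mult.commute)
    from tendsto_diff[OF b this] show ?thesis by simp
  qed
  have "(\<lambda>n. c n - of_nat n * c (n - 1)) = (\<lambda>n. d n - of_nat n * d (n - 1))"
    using eq unfolding c(2) d(2) S_op_mahler_series[OF c(1)] S_op_mahler_series[OF d(1)]
    by (intro mahler_series_inj lim c(1) d(1))
  then have step: "c n - of_nat n * c (n - 1) = d n - of_nat n * d (n - 1)" for n by meson
  have "c n = d n" for n
  proof (induction n)
    case 0
    show ?case using step[of 0] by simp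
  next
    case (Suc n)
    then show ?case using step[of "Suc n"] by simp
  qed
  then show "f = g" unfolding c d by presburger
qed

lemma S_inv_eqI:
  fixes f :: "'a \<Rightarrow> 'a"
  assumes "f \<in> padic_cont" "S_op f = g"
  shows "S_inv g = f"
  unfolding S_inv_def assms(2)[symmetric] by (rule inv_into_f_f[OF S_op_inj assms(1)])

text \<open>Since \<open>n! - n (n - 1)!\<close> is 0 for positive \<open>n\<close>, the series on the right is a preimage of 1.\<close>

lemma q_fun_eq: "q_fun = mahler_series (\<lambda>n. fact n :: 'a)"
  unfolding q_fun_def
proof (rule S_inv_eqI)
  show "mahler_series (\<lambda>n. fact n :: 'a) \<in> padic_cont"
    by (rule mahler_series_padic_cont[OF fact_tendsto_0])
  have coeff: "fact n - of_nat n * fact (n - 1) = (if n = 0 then 1 else 0 :: 'a)" for n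
    by (cases n) (auto simp: algebra_simps)
  have "mahler_series (\<lambda>n. if n = 0 then 1 else 0 :: 'a) x = 1" if "x \<in> padic_integers" for x
    using that sums_single[of 0 "\<lambda>_. 1 :: 'a"]
    by (intro mahler_series_eqI) (auto simp: if_distrib[of "\<lambda>c. c * _"] cong: if_cong
      elim!: back_subst[of "\<lambda>f. f sums _"])
  then show "S_op (mahler_series (\<lambda>n. fact n :: 'a)) = (\<lambda>x\<in>padic_integers. 1)"
    unfolding S_op_mahler_series[OF fact_tendsto_0] coeff
    by (auto simp: mahler_series_def fun_eq_iff)
qed

lemma shifted_fact_tendsto_0: "(\<lambda>n. fact (n + m) / fact m :: 'a) \<longlonglongrightarrow> 0"
  using tendsto_mult_left[OF LIMSEQ_ignore_initial_segment[OF fact_tendsto_0, of m], of "1 / fact m"]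
  by simp

text \<open>
  In the inductive step, the coefficients satisfy
  \<open>(n + m + 1)! - n (n + m)! = (m + 1) (n + m)!\<close>.
\<close>

lemma S_inv_power_q_fun:
  "(S_inv ^^ m) q_fun = mahler_series (\<lambda>n. fact (n + m) / fact m :: 'a)"
proof (induction m)
  case 0
  show ?case by (simp add: q_fun_eq)
next
  case (Suc m)
  have coeff: "fact (n + Suc m) / fact (Suc m) - of_nat n * (fact (n - 1 + Suc m) / fact (Suc m))
      = (fact (n + m) / fact m :: 'a)" for n
  proof (cases n)
    case (Suc k)
    have "(of_nat (Suc m) :: 'a) \<noteq> 0" by (simp only: of_nat_eq_0_iff)
    moreover have "(fact (n + Suc m) :: 'a) - of_nat n * fact (n - 1 + Suc m)
        = of_nat (Suc m) * fact (n + m)"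
      by (simp add: Suc algebra_simps)
    ultimately show ?thesis
      by (simp add: diff_divide_distrib[symmetric] fact_Suc[of m] del: of_nat_Suc add_Suc_right)
  qed (simp del: fact_Suc)
  show ?case
    unfolding funpow.simps o_apply Suc.IH
  proof (rule S_inv_eqI)
    show "mahler_series (\<lambda>n. fact (n + Suc m) / fact (Suc m) :: 'a) \<in> padic_cont"
      by (rule mahler_series_padic_cont[OF shifted_fact_tendsto_0])
    show "S_op (mahler_series (\<lambda>n. fact (n + Suc m) / fact (Suc m) :: 'a)) =
        mahler_series (\<lambda>n. fact (n + m) / fact m)"
      unfolding S_op_mahler_series[OF shifted_fact_tendsto_0] coeff ..
  qed
qed

lemma nabla_power_q_fun:
  "(\<lambda>x\<in>padic_integers. 1 / fact n * (nabla ^^ n) q_fun x) = (S_inv ^^ n) (q_fun :: 'a \<Rightarrow> 'a)"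
proof
  fix x :: 'a
  have lim: "(\<lambda>k. fact (k + n) :: 'a) \<longlonglongrightarrow> 0"
    by (rule LIMSEQ_ignore_initial_segment[OF fact_tendsto_0])
  show "(\<lambda>x\<in>padic_integers. 1 / fact n * (nabla ^^ n) q_fun x) x = (S_inv ^^ n) q_fun x"
  proof (cases "x \<in> padic_integers")
    case True
    then show ?thesis
      using mahler_series_scale[OF lim True, of "1 / fact n"]
      unfolding S_inv_power_q_fun
      by (simp add: q_fun_eq nabla_power_mahler_series[OF fact_tendsto_0])
  next
    case False
    then show ?thesis by (simp add: S_inv_power_q_fun mahler_series_def)
  qed
qed

lemma I_op_eq: "I_op \<psi> = mahler_series (\<lambda>n. fact n * \<psi> (- 1 - of_nat n))"
  by (simp add: I_op_def mahler_series_def)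

lemma minus_1_minus_nat: "- 1 - of_nat n \<in> (padic_integers :: 'a set)"
  by (intro padic_integers_diff padic_integers_minus) auto

lemma I_op_coeff_tendsto_0:
  fixes \<psi> :: "'a \<Rightarrow> 'a"
  assumes \<psi>: "\<psi> \<in> padic_cont"
  shows "(\<lambda>n. fact n * \<psi> (- 1 - of_nat n)) \<longlonglongrightarrow> 0"
proof -
  obtain B where "\<And>x. x \<in> padic_integers \<Longrightarrow> vabs (\<psi> x) \<le> B"
    using padic_cont_bounded[OF \<psi>] by blast
  then show ?thesis
    by (intro tendsto_0_mult_bounded[OF fact_tendsto_0]) (use minus_1_minus_nat in blast)
qed

text \<open>
  The coefficients of \<open>I_op \<psi>\<close> determine \<open>\<psi>\<close> on the negative integers. These are dense, because
  the continuous involution \<open>x \<mapsto> -1 - x\<close> of the p-adic integers maps the natural numbers onto them.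
\<close>

lemma I_op_inj: "inj_on I_op (padic_cont :: ('a \<Rightarrow> 'a) set)"
proof (rule inj_onI)
  fix f g :: "'a \<Rightarrow> 'a"
  assume f: "f \<in> padic_cont" and g: "g \<in> padic_cont" and eq: "I_op f = I_op g"
  have "(\<lambda>n. fact n * f (- 1 - of_nat n)) = (\<lambda>n. fact n * g (- 1 - of_nat n))"
    using eq unfolding I_op_eq by (intro mahler_series_inj I_op_coeff_tendsto_0 f g)
  then have nat: "f (- 1 - of_nat n) = g (- 1 - of_nat n)" for n
    by (metis fact_nonzero mult_left_cancel)
  have reflect: "- 1 - x \<in> padic_integers" if "x \<in> padic_integers" for x :: 'a
    using that by (intro padic_integers_diff padic_integers_minus) auto
  have cont: "continuous_on padic_integers (\<lambda>x. h (- 1 - x))" if "h \<in> padic_cont" for h :: "'a \<Rightarrow> 'a"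
  proof (rule continuous_on_compose2[of padic_integers h padic_integers "\<lambda>x. - 1 - x"])
    show "continuous_on padic_integers h" using that by (simp add: padic_cont_def)
    show "continuous_on padic_integers (\<lambda>x :: 'a. - 1 - x)" by (intro continuous_intros)
  qed (use reflect in blast)
  have "f x = g x" if "x \<in> padic_integers" for x
    using eq_on_padic_integers[OF cont[OF f] cont[OF g] nat reflect[OF that]] by simp
  then show "f = g"
    using f g unfolding padic_cont_def by (blast intro: extensionalityI)
qed

text \<open>
  Upper negation of binomial coefficients. The left side is the Mahler coefficient number \<open>k\<close> of
  \<open>(-1)\<^sup>m S\<^sup>-\<^sup>m q\<close>, the right side that of the image under \<open>I_op\<close> of the binomial function of
  degree \<open>m\<close>.
\<close>

lemma shifted_fact_eq_gbinomial:
  "(- 1) ^ m * (fact (k + m) / fact m) = fact k * ((- 1 - of_nat k :: 'a) gchoose m)"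
proof -
  have "(- 1 - of_nat k :: 'a) gchoose m = (- 1) ^ m * (of_nat (k + m) gchoose m)"
    using gbinomial_minus[of "1 + of_nat k :: 'a" m] by (simp add: algebra_simps)
  also have "(of_nat (k + m) gchoose m :: 'a) = fact (k + m) / (fact m * fact k)"
    using binomial_fact[of m "k + m", where 'a = 'a] by (simp add: binomial_gbinomial)
  finally show ?thesis by simp
qed

text \<open>
  The difference between a partial sum and \<open>I_op \<psi>\<close> is a Mahler series. Its coefficient number \<open>k\<close>
  is \<open>k!\<close> times the error of the corresponding partial sum of the Mahler series of \<open>\<psi>\<close> at the
  point \<open>-1 - k\<close>, and this error is small uniformly in \<open>k\<close>.
\<close>

lemma I_op_mahler_series_sums:
  fixes a :: "nat \<Rightarrow> 'a"
  assumes a: "a \<longlonglongrightarrow> 0"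
  shows "padic_cont_sums (\<lambda>n x. a n * (- 1) ^ n * (S_inv ^^ n) q_fun x) (I_op (mahler_series a))"
  unfolding padic_cont_sums_def
proof
  let ?\<psi> = "mahler_series a"
  let ?F = "\<lambda>n x. a n * (- 1) ^ n * (S_inv ^^ n) q_fun x"
  let ?c = "\<lambda>k. fact k * ?\<psi> (- 1 - of_nat k)"
  let ?d = "\<lambda>n k. a n * (- 1) ^ n * (fact (k + n) / fact n)"
  have c: "?c \<longlonglongrightarrow> 0" by (rule I_op_coeff_tendsto_0[OF mahler_series_padic_cont[OF a]])
  show "I_op ?\<psi> \<in> padic_cont"
    unfolding I_op_eq by (rule mahler_series_padic_cont[OF c])
  have d: "?d n \<longlonglongrightarrow> 0" for n
    using tendsto_mult_left[OF shifted_fact_tendsto_0[of n], of "a n * (- 1) ^ n"] by simp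
  then have sum_d: "(\<lambda>k. \<Sum>n<N. ?d n k) \<longlonglongrightarrow> 0" for N
    by (intro tendsto_null_sum)
  have d_eq: "?d n k = fact k * (a n * (- 1 - of_nat k gchoose n))" for n k
    using shifted_fact_eq_gbinomial[of n k] by (metis mult.assoc mult.left_commute)
  show "uniform_limit padic_integers (\<lambda>N x. \<Sum>n<N. ?F n x) (I_op ?\<psi>) sequentially"
    unfolding uniform_limit_sequentially_iff
  proof (intro allI impI)
    fix e :: real assume "e > 0"
    then obtain N0 where N0: "\<And>N y. N \<ge> N0 \<Longrightarrow> y \<in> padic_integers \<Longrightarrow>
        dist (\<Sum>n<N. a n * (y gchoose n)) (?\<psi> y) < e / 2"
      using uniform_limit_mahler_series[OF a] unfolding uniform_limit_sequentially_iff
      by (meson half_gt_zero)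
    have "dist (\<Sum>n<N. ?F n x) (I_op ?\<psi> x) < e" if N: "N \<ge> N0" and x: "x \<in> padic_integers" for N x
    proof -
      have "(\<Sum>n<N. ?F n x) = (\<Sum>n<N. mahler_series (?d n) x)"
        unfolding S_inv_power_q_fun mahler_series_scale[OF shifted_fact_tendsto_0 x] ..
      also have "\<dots> = mahler_series (\<lambda>k. \<Sum>n<N. ?d n k) x"
        by (rule mahler_series_sum[OF d x, symmetric])
      finally have "(\<Sum>n<N. ?F n x) - I_op ?\<psi> x = mahler_series (\<lambda>k. (\<Sum>n<N. ?d n k) - ?c k) x"
        unfolding I_op_eq mahler_series_diff[OF sum_d c x] by (rule arg_cong)
      moreover have "vabs (mahler_series (\<lambda>k. (\<Sum>n<N. ?d n k) - ?c k) x) \<le> e / 2"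
      proof (rule vabs_mahler_series_le[OF _ x])
        show "(\<lambda>k. (\<Sum>n<N. ?d n k) - ?c k) \<longlonglongrightarrow> 0"
          using tendsto_diff[OF sum_d c] by simp
        fix k
        let ?r = "(\<Sum>n<N. a n * (- 1 - of_nat k gchoose n)) - ?\<psi> (- 1 - of_nat k)"
        have "(\<Sum>n<N. ?d n k) - ?c k = fact k * ?r"
          unfolding d_eq sum_distrib_left[symmetric] by (rule right_diff_distrib[symmetric])
        moreover have "vabs (fact k :: 'a) \<le> 1"
          using vabs_of_nat_le_1[of "fact k", where 'a = 'a] by simp
        then have "vabs (fact k * ?r) \<le> vabs ?r"
          unfolding vabs_mult by (rule mult_left_le_one_le[OF vabs_nonneg vabs_nonneg])
        moreover have "vabs ?r \<le> e / 2"
          using N0[OF N minus_1_minus_nat[of k]] by (simp add: dist_vabs)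
        ultimately show "vabs ((\<Sum>n<N. ?d n k) - ?c k) \<le> e / 2" by simp
      qed
      ultimately show ?thesis using \<open>e > 0\<close> by (simp add: dist_vabs)
    qed
    then show "\<exists>N0. \<forall>N\<ge>N0. \<forall>x\<in>padic_integers. dist (\<Sum>n<N. ?F n x) (I_op ?\<psi> x) < e" by blast
  qed
qed

end

lemma padic_cont_sums_unique:
  assumes "padic_cont_sums F f" "padic_cont_sums F g"
  shows "f = g"
proof -
  have lim: "uniform_limit padic_integers (\<lambda>N x. \<Sum>n<N. F n x) f sequentially"
      "uniform_limit padic_integers (\<lambda>N x. \<Sum>n<N. F n x) g sequentially"
    and ext: "f \<in> extensional padic_integers" "g \<in> extensional padic_integers"
    using assms by (simp_all add: padic_cont_sums_def padic_cont_def)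
  show ?thesis
    using ext by (rule extensionalityI) (rule LIMSEQ_unique[OF lim[THEN tendsto_uniform_limitI]])
qed

lemma padic_abs_prime:
  assumes "prime p"
  shows "padic_abs p (of_nat p) = 1 / real p"
proof -
  have "quotient_of (of_nat p) = (int p, 1)"
    using quotient_of_int[of "int p"] by (simp add: Rat.of_int_def)
  moreover have "multiplicity (int p) (int p) = 1"
    using assms prime_gt_1_nat[OF assms] by (intro multiplicity_self) auto
  ultimately show ?thesis
    using prime_gt_0_nat[OF assms] by (simp add: padic_abs_def power_int_minus field_simps)
qed

lemma padic_ambient_complex_padic_field:
  assumes "prime p" "is_complex_padic_field TYPE('a::nonarchimedean_field) p"
  shows "padic_ambient TYPE('a) p"
proof
  have "vabs (of_rat (of_nat p) :: 'a) = padic_abs p (of_nat p)"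
    using assms(2) unfolding is_complex_padic_field_def by blast
  then show "vabs (of_nat p :: 'a) = 1 / real p"
    by (simp add: padic_abs_prime[OF assms(1)])
  show "complete (UNIV :: 'a set)"
    using assms(2) unfolding is_complex_padic_field_def by blast
qed fact

section \<open>The image of the operator I\<close>

theorem corollary6p17:
  fixes p :: nat
  assumes "prime p"
    and "is_complex_padic_field TYPE('a::nonarchimedean_field) p"
  shows "(\<forall>n. (\<lambda>x\<in>padic_integers. 1 / fact n * (nabla ^^ n) q_fun x)
              = (S_inv ^^ n) (q_fun :: 'a \<Rightarrow> 'a)) \<and>
    (\<forall>a :: nat \<Rightarrow> 'a. a \<longlonglongrightarrow> 0 \<longrightarrow>
       (\<exists>\<Psi>. padic_cont_sums (\<lambda>n x. a n * (- 1) ^ n * (S_inv ^^ n) q_fun x) \<Psi>)) \<and>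
    I_op ` (padic_cont :: ('a \<Rightarrow> 'a) set) =
      {\<Psi>. \<exists>a. a \<longlonglongrightarrow> 0 \<and>
         padic_cont_sums (\<lambda>n x. a n * (- 1) ^ n * (S_inv ^^ n) q_fun x) \<Psi>} \<and>
    (\<forall>\<Psi> \<in> I_op ` (padic_cont :: ('a \<Rightarrow> 'a) set).
       \<exists>!a. a \<longlonglongrightarrow> 0 \<and>
         padic_cont_sums (\<lambda>n x. a n * (- 1) ^ n * (S_inv ^^ n) q_fun x) \<Psi>)"
proof -
  interpret padic_ambient "TYPE('a)" p
    using assms by (rule padic_ambient_complex_padic_field)
  let ?sums = "\<lambda>(a :: nat \<Rightarrow> 'a). padic_cont_sums (\<lambda>n x. a n * (- 1) ^ n * (S_inv ^^ n) q_fun x)"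
  have sums_iff: "?sums a \<Psi> \<longleftrightarrow> \<Psi> = I_op (mahler_series a)" if "a \<longlonglongrightarrow> 0" for a \<Psi>
  proof
    show "?sums a \<Psi> \<Longrightarrow> \<Psi> = I_op (mahler_series a)"
      using I_op_mahler_series_sums[OF that] by (rule padic_cont_sums_unique[rotated])
    show "\<Psi> = I_op (mahler_series a) \<Longrightarrow> ?sums a \<Psi>"
      using I_op_mahler_series_sums[OF that] by simp
  qed
  have expand: "\<exists>a. a \<longlonglongrightarrow> 0 \<and> \<psi> = mahler_series a" if "\<psi> \<in> padic_cont" for \<psi> :: "'a \<Rightarrow> 'a"
    using nabla_power_at_0_tendsto_0[OF that] Mahler[OF that] by blast
  have image: "I_op ` padic_cont = {\<Psi>. \<exists>a. a \<longlonglongrightarrow> 0 \<and> ?sums a \<Psi>}"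
  proof (intro equalityI subsetI)
    fix \<Psi> :: "'a \<Rightarrow> 'a" assume "\<Psi> \<in> I_op ` padic_cont"
    then obtain \<psi> where "\<psi> \<in> padic_cont" and \<Psi>: "\<Psi> = I_op \<psi>" by blast
    then obtain a where a: "a \<longlonglongrightarrow> 0" "\<psi> = mahler_series a" using expand by blast
    then have "?sums a \<Psi>" using sums_iff[OF a(1)] \<Psi> by simp
    with a(1) show "\<Psi> \<in> {\<Psi>. \<exists>a. a \<longlonglongrightarrow> 0 \<and> ?sums a \<Psi>}" by blast
  next
    fix \<Psi> :: "'a \<Rightarrow> 'a" assume "\<Psi> \<in> {\<Psi>. \<exists>a. a \<longlonglongrightarrow> 0 \<and> ?sums a \<Psi>}"
    then obtain a where a: "a \<longlonglongrightarrow> 0" "?sums a \<Psi>" by blast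
    then have "\<Psi> = I_op (mahler_series a)" using sums_iff[OF a(1)] by simp
    then show "\<Psi> \<in> I_op ` padic_cont" using mahler_series_padic_cont[OF a(1)] by simp
  qed
  have unique: "a = b" if ab: "a \<longlonglongrightarrow> 0" "b \<longlonglongrightarrow> 0" "?sums a \<Psi>" "?sums b \<Psi>" for a b \<Psi>
  proof (rule mahler_series_inj[OF ab(1,2)])
    have "I_op (mahler_series a) = I_op (mahler_series b)"
      using ab(3,4) sums_iff[OF ab(1)] sums_iff[OF ab(2)] by simp
    then show "mahler_series a = mahler_series b"
      by (rule inj_onD[OF I_op_inj]) (intro mahler_series_padic_cont ab(1,2))+
  qed
  show ?thesis
  proof (intro conjI allI impI ballI)
    fix n show "(\<lambda>x\<in>padic_integers. 1 / fact n * (nabla ^^ n) q_fun x)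
              = (S_inv ^^ n) (q_fun :: 'a \<Rightarrow> 'a)"
      by (rule nabla_power_q_fun)
  next
    fix a :: "nat \<Rightarrow> 'a" assume "a \<longlonglongrightarrow> 0"
    then have sums: "?sums a (I_op (mahler_series a))" by (rule I_op_mahler_series_sums)
    show "\<exists>\<Psi>. ?sums a \<Psi>" by (rule exI) (rule sums)
  next
    fix \<Psi> :: "'a \<Rightarrow> 'a" assume "\<Psi> \<in> I_op ` padic_cont"
    then obtain a where "a \<longlonglongrightarrow> 0" "?sums a \<Psi>" unfolding image by blast
    then show "\<exists>!a. a \<longlonglongrightarrow> 0 \<and> ?sums a \<Psi>" by (blast intro: unique)
  qed (rule image)
qed

end
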